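(* Consider a network with $M$ nodes which is homogeneous in $p$ ($p_j=p$ for all $j$) and heterogeneous in $q$, with internal rates $\{q_{i,j}\}$, and let $q_j=\sum_{k\neq j}q_{k,j}$. Then the expected fraction of adopters $f(t)$ satisfies $$f'(0)=p,\qquad f''(0)=p\Big(\frac1M\sum_{j=1}^M q_j-p\Big).$$ If, in addition, the heterogeneity in $q$ is mild, i.e. $q_{i,j}=\frac{q_j}{\mathrm{degree}(j)}$ if $i$ influences $j$ and $q_{i,j}=0$ otherwise, then $$f'''(0)=p^3+\frac pM\left(\frac{M-2}{(M-1)^2}\Big(\sum_{i=1}^M q_i\Big)^2-\frac{2M-3}{(M-1)^2}\sum_{i=1}^M q_i^2-4p\sum_{i=1}^M q_i\right).$$
   Context: Discrete Bass model: a network (a weighted directed graph, of any structure) has $M$ nodes, external rates $p_j\ge 0$ and internal rates $q_{i,j}\ge 0$ ($i\ne j$; the influence of $i$ on $j$, with $q_{i,j}=0$ if there is no edge from $i$ to $j$). $X_j(t)\in\{0,1\}$ is the state of node $j$ ($1$ = adopter), $X_j(0)=0$ for all $j$. The process $(X_1,\dots,X_M)$ is a continuous-time Markov chain in which adopters remain adopters forever, and each nonadopter $j$ becomes an adopter at rate $p_j+\sum_{k\ne j}q_{k,j}X_k(t)$ (one node changes at a time). It is assumed that $q_j=\sum_{k\ne j}q_{k,j}>0$ for all $j$. The degree of $j$, $\mathrm{degree}(j)$, is the number of peers of $j$, i.e. of nodes that influence $j$. The expected fraction of adopters is $f(t)=\frac1M\,\mathbf{E}\big[\sum_{j=1}^M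 X_j(t)\big]$. Derivatives at $t=0$ are one-sided.
   Formalization: The formula for f'''(0) is proved only for complete networks (every node influences every other, so degree(j)=M-1); for general mildly heterogeneous networks it is false, e.g. on the directed 4-cycle with equal weights r>0 and p>0 it is off by pr²/3. *)

theory Defs
  imports "HOL-Probability.Probability"
begin

text \<open>
  Time-homogeneous continuous-time Markov chain on a finite state space with transition rates
  \<open>Q x y\<close>, in infinitesimal form.  All conditional probabilities are guarded by the
  positivity of the conditioning event, since division by zero is total.  Only times
  \<open>t \<ge> 0\<close> are meaningful.
\<close>

locale finite_ctmc = prob_space P
  for P :: "'w measure" +
  fixes X :: "real \<Rightarrow> 'w \<Rightarrow> 's :: finite"
    and Q :: "'s \<Rightarrow> 's \<Rightarrow> real"
  assumes measurable_X: "t \<ge> 0 \<Longrightarrow> X t \<in> measurable P (count_space UNIV)"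
    and markov:
      "\<lbrakk>finite S; S \<subseteq> {0..<t}; t \<ge> 0; h \<ge> 0;
        \<P>(\<omega> in P. X t \<omega> = x \<and> (\<forall>s\<in>S. X s \<omega> = z s)) > 0\<rbrakk>
       \<Longrightarrow> \<P>(\<omega> in P. X (t + h) \<omega> = y \<bar> X t \<omega> = x \<and> (\<forall>s\<in>S. X s \<omega> = z s))
         = \<P>(\<omega> in P. X (t + h) \<omega> = y \<bar> X t \<omega> = x)"
    and time_homogeneous:
      "\<lbrakk>s \<ge> 0; t \<ge> 0; h \<ge> 0; \<P>(\<omega> in P. X s \<omega> = x) > 0; \<P>(\<omega> in P. X t \<omega> = x) > 0\<rbrakk>
       \<Longrightarrow> \<P>(\<omega> in P. X (s + h) \<omega> = y \<bar> X s \<omega> = x)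
         = \<P>(\<omega> in P. X (t + h) \<omega> = y \<bar> X t \<omega> = x)"
    and transition_rates:
      "\<lbrakk>t \<ge> 0; \<P>(\<omega> in P. X t \<omega> = x) > 0\<rbrakk>
       \<Longrightarrow> ((\<lambda>h. (\<P>(\<omega> in P. X (t + h) \<omega> = y \<bar> X t \<omega> = x) - of_bool (y = x)) / h)
             \<longlongrightarrow> Q x y) (at_right 0)"

text \<open>
  The nodes are the elements of a finite type, so the number of nodes is \<open>CARD('n)\<close>.
  \<open>q i j\<close> is the rate at which \<open>i\<close> influences \<open>j\<close>; the diagonal of \<open>q\<close>
  is never used.  A state \<open>x\<close> of the network maps each node to whether it has adopted.
\<close>

definition internal_rate :: "('n::finite \<Rightarrow> 'n \<Rightarrow> real) \<Rightarrow> 'n \<Rightarrow> real" where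
  "internal_rate q j = (\<Sum>k\<in>UNIV - {j}. q k j)"

definition adoption_rate ::
    "('n::finite \<Rightarrow> real) \<Rightarrow> ('n \<Rightarrow> 'n \<Rightarrow> real) \<Rightarrow> ('n \<Rightarrow> bool) \<Rightarrow> 'n \<Rightarrow> real" where
  "adoption_rate p q x j = p j + (\<Sum>k\<in>UNIV - {j}. q k j * of_bool (x k))"

text \<open>
  Off the diagonal the index set of the sum is empty or a singleton: the only transitions are
  those in which exactly one nonadopter adopts.
\<close>

definition bass_generator ::
    "('n::finite \<Rightarrow> real) \<Rightarrow> ('n \<Rightarrow> 'n \<Rightarrow> real) \<Rightarrow> ('n \<Rightarrow> bool) \<Rightarrow> ('n \<Rightarrow> bool) \<Rightarrow> real" where
  "bass_generator p q x y =
     (if y = x then - (\<Sum>j | \<not> x j. adoption_rate p q x j)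
      else (\<Sum>j | \<not> x j \<and> y = x(j := True). adoption_rate p q x j))"

locale discrete_bass = finite_ctmc P X "bass_generator p q"
  for P :: "'w measure"
    and X :: "real \<Rightarrow> 'w \<Rightarrow> 'n::finite \<Rightarrow> bool"
    and p :: "'n \<Rightarrow> real"
    and q :: "'n \<Rightarrow> 'n \<Rightarrow> real" +
  assumes p_nonneg: "p j \<ge> 0"
    and q_nonneg: "i \<noteq> j \<Longrightarrow> q i j \<ge> 0"
    and internal_rate_pos: "internal_rate q j > 0"
    and initially_nonadopter: "\<omega> \<in> space P \<Longrightarrow> \<not> X 0 \<omega> j"
    and remains_adopter: "\<lbrakk>\<omega> \<in> space P; 0 \<le> s; s \<le> t; X s \<omega> j\<rbrakk> \<Longrightarrow> X t \<omega> j"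

definition adopter_fraction ::
    "'w measure \<Rightarrow> (real \<Rightarrow> 'w \<Rightarrow> 'n::finite \<Rightarrow> bool) \<Rightarrow> real \<Rightarrow> real" where
  "adopter_fraction P X t =
     1 / real CARD('n) * (\<integral>\<omega>. (\<Sum>j\<in>UNIV. of_bool (X t \<omega> j)) \<partial>P)"

definition influences :: "('n::finite \<Rightarrow> 'n \<Rightarrow> real) \<Rightarrow> 'n \<Rightarrow> 'n \<Rightarrow> bool" where
  "influences q i j \<longleftrightarrow> i \<noteq> j \<and> q i j > 0"

definition node_degree :: "('n::finite \<Rightarrow> 'n \<Rightarrow> real) \<Rightarrow> 'n \<Rightarrow> nat" where
  "node_degree q j = card {i. influences q i j}"

definition mild_heterogeneity :: "('n::finite \<Rightarrow> 'n \<Rightarrow> real) \<Rightarrow> bool" where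
  "mild_heterogeneity q \<longleftrightarrow>
     (\<forall>i j. i \<noteq> j \<longrightarrow>
        q i j = (if influences q i j then internal_rate q j / real (node_degree q j) else 0))"

text \<open>
  On a network that is not complete, the third derivative of the adopter fraction at 0 depends
  on the degrees and not only on the number of nodes and the \<open>q\<^sub>j\<close>.  For the directed
  4-cycle with all edges of weight \<open>r\<close> it is \<open>p^3 - 4 * p^2 * r\<close>, whereas the
  formula with denominators \<open>(M - 1)^2\<close> would give an additional \<open>p * r^2 / 3\<close>.
\<close>

definition complete_network :: "('n::finite \<Rightarrow> 'n \<Rightarrow> real) \<Rightarrow> bool" where
  "complete_network q \<longleftrightarrow> (\<forall>i j. i \<noteq> j \<longrightarrow> influences q i j)"

text \<open>
  \<open>D\<close> is the \<open>n\<close>-th derivative at 0 of \<open>f\<close> as a function on \<open>[0, \<infinity>)\<close>,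
  one-sided at 0.  The sequence \<open>F\<close> lists the successive derivatives; it includes the claim
  that \<open>f\<close> is \<open>n\<close> times differentiable on \<open>[0, \<infinity>)\<close>, and it is determined
  there by \<open>f\<close>.
\<close>

definition has_nth_deriv_at_0 :: "nat \<Rightarrow> (real \<Rightarrow> real) \<Rightarrow> real \<Rightarrow> bool" where
  "has_nth_deriv_at_0 n f D \<longleftrightarrow>
     (\<exists>F. F 0 = f
        \<and> (\<forall>i<n. \<forall>t\<ge>0. (F i has_real_derivative F (Suc i) t) (at t within {0..}))
        \<and> F n 0 = D)"

end

theory Submission
  imports Defs
begin

text \<open>
  By time homogeneity the transition function can be read off at any time at which the state has
  positive probability.  The law of the chain therefore satisfies the Chapman--Kolmogorov equations
  with a single transition function, which makes difference quotients from the left and from the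
  right accessible alike and yields the forward equation.  Hence the derivative of
  \<open>E \<phi>(X\<^sub>t)\<close> is \<open>E (A \<phi>)(X\<^sub>t)\<close>, where \<open>A\<close> is the generator, and the \<open>n\<close>-th derivative at \<open>0\<close> is
  \<open>(A\<^sup>n \<phi>)(x\<^sub>0)\<close>.  For the Bass model one applies \<open>A\<close> repeatedly to the number of adopters.
\<close>

lemma has_nth_deriv_at_0_cmult:
  assumes "has_nth_deriv_at_0 n f D"
  shows "has_nth_deriv_at_0 n (\<lambda>t. c * f t) (c * D)"
proof -
  from assms obtain F where "F 0 = f" "F n 0 = D"
    and "\<And>i t. i < n \<Longrightarrow> t \<ge> 0 \<Longrightarrow> (F i has_real_derivative F (Suc i) t) (at t within {0..})"
    unfolding has_nth_deriv_at_0_def by blast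
  then show ?thesis
    unfolding has_nth_deriv_at_0_def
    by (intro exI[of _ "\<lambda>i t. c * F i t"]) (auto intro!: DERIV_cmult)
qed

definition generator_apply :: "('s::finite \<Rightarrow> 's \<Rightarrow> real) \<Rightarrow> ('s \<Rightarrow> real) \<Rightarrow> 's \<Rightarrow> real" where
  "generator_apply Q \<phi> x = (\<Sum>y\<in>UNIV. Q x y * \<phi> y)"

section \<open>The forward equation\<close>

context finite_ctmc
begin

section \<open>A transition function that does not depend on the starting time\<close>

definition law :: "real \<Rightarrow> 's \<Rightarrow> real" where
  "law t x = \<P>(\<omega> in P. X t \<omega> = x)"

text \<open>Rates are prescribed only at states that have positive probability at some time; all
  other states need separate treatment.\<close>

definition reachable :: "'s \<Rightarrow> bool" where
  "reachable x \<longleftrightarrow> (\<exists>t\<ge>0. law t x > 0)"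

text \<open>\<open>SOME\<close> picks one time of positive probability; time homogeneity makes the
  choice immaterial. At the other states the identity is a default whose rate exists and is 0, so
  that a rate is available for every \<open>x\<close>.\<close>

definition trans_prob :: "real \<Rightarrow> 's \<Rightarrow> 's \<Rightarrow> real" where
  "trans_prob h x y =
     (if reachable x
      then let t = SOME t. t \<ge> 0 \<and> law t x > 0 in \<P>(\<omega> in P. X (t + h) \<omega> = y \<bar> X t \<omega> = x)
      else of_bool (y = x))"

lemma law_nonneg: "law t x \<ge> 0"
  by (simp add: law_def)

lemma law_le_1: "law t x \<le> 1"
  by (simp add: law_def)

lemma state_event_measurable [measurable]:
  "t \<ge> 0 \<Longrightarrow> {\<omega> \<in> space P. X t \<omega> = x} \<in> events"
  using measurable_sets[OF measurable_X, of t "{x}"] by (simp add: vimage_def Int_def conj_commute)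

lemma trans_prob_eq_cond_prob:
  assumes "t \<ge> 0" "h \<ge> 0" "law t x > 0"
  shows "trans_prob h x y = \<P>(\<omega> in P. X (t + h) \<omega> = y \<bar> X t \<omega> = x)"
proof -
  have "reachable x"
    using assms by (auto simp: reachable_def)
  define s where "s = (SOME t. t \<ge> 0 \<and> law t x > 0)"
  have "s \<ge> 0 \<and> law s x > 0"
    unfolding s_def by (rule someI[of _ t]) (use assms in auto)
  then have "\<P>(\<omega> in P. X (s + h) \<omega> = y \<bar> X s \<omega> = x) = \<P>(\<omega> in P. X (t + h) \<omega> = y \<bar> X t \<omega> = x)"
    using assms by (intro time_homogeneous) (auto simp: law_def)
  then show ?thesis
    using \<open>reachable x\<close> by (simp add: trans_prob_def Let_def s_def)
qed

text \<open>Total probability over the state at time \<open>t\<close>. A state of law 0 adds nothing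
  on either side, whatever value \<open>trans_prob\<close> has there.\<close>

lemma law_step:
  assumes "t \<ge> 0" "h \<ge> 0"
  shows "law (t + h) y = (\<Sum>x\<in>UNIV. law t x * trans_prob h x y)"
proof -
  have "law (t + h) y = (\<Sum>x\<in>UNIV. \<P>(\<omega> in P. X (t + h) \<omega> = y \<and> X t \<omega> = x))"
  proof -
    have "{\<omega> \<in> space P. X (t + h) \<omega> = y} =
        (\<Union>x. {\<omega> \<in> space P. X (t + h) \<omega> = y \<and> X t \<omega> = x})"
      by auto
    moreover have "{\<omega> \<in> space P. X (t + h) \<omega> = y \<and> X t \<omega> = x} \<in> events" for x
      using sets.Int[OF state_event_measurable[of "t + h" y] state_event_measurable[of t x]] assms
      by (simp add: Int_def conj_ac cong: conj_cong)
    ultimately show ?thesis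
      unfolding law_def
      by (auto intro!: finite_measure_finite_Union simp: disjoint_family_on_def)
  qed
  also have "\<dots> = (\<Sum>x\<in>UNIV. law t x * trans_prob h x y)"
  proof (rule sum.cong[OF refl])
    fix x
    show "\<P>(\<omega> in P. X (t + h) \<omega> = y \<and> X t \<omega> = x) = law t x * trans_prob h x y"
    proof (cases "law t x > 0")
      case True
      then show ?thesis
        using assms by (simp add: trans_prob_eq_cond_prob cond_prob_def law_def)
    next
      case False
      then have "law t x = 0"
        using law_nonneg[of t x] by simp
      moreover have "\<P>(\<omega> in P. X (t + h) \<omega> = y \<and> X t \<omega> = x) \<le> law t x"
        unfolding law_def using assms by (intro finite_measure_mono) auto
      ultimately show ?thesis
        by (simp add: measure_le_0_iff)
    qed
  qed
  finally show ?thesis .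
qed

lemma trans_prob_rate:
  "((\<lambda>h. (trans_prob h x y - of_bool (y = x)) / h) \<longlongrightarrow> (if reachable x then Q x y else 0))
     (at_right 0)"
proof (cases "reachable x")
  case True
  then obtain t where t: "t \<ge> 0" "law t x > 0"
    by (auto simp: reachable_def)
  have "((\<lambda>h. (\<P>(\<omega> in P. X (t + h) \<omega> = y \<bar> X t \<omega> = x) - of_bool (y = x)) / h) \<longlongrightarrow> Q x y) (at_right 0)"
    using t by (intro transition_rates) (auto simp: law_def)
  moreover have "\<forall>\<^sub>F h in at_right 0. (\<P>(\<omega> in P. X (t + h) \<omega> = y \<bar> X t \<omega> = x) - of_bool (y = x)) / h
      = (trans_prob h x y - of_bool (y = x)) / h"
    by (rule eventually_mono[OF eventually_at_right_less[of 0]])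
      (use t in \<open>simp add: trans_prob_eq_cond_prob\<close>)
  ultimately show ?thesis
    unfolding if_P[OF True] by (rule Lim_transform_eventually)
next
  case False
  then show ?thesis
    by (simp add: trans_prob_def)
qed

text \<open>The rates are limits as the step length decreases to 0. A left quotient at
  \<open>t\<close> is a forward step of length \<open>t - s\<close> started at \<open>s\<close>;
  with weights taken at \<open>min s t\<close>, one formula serves both sides.\<close>

lemma law_difference_quotient:
  assumes "s \<ge> 0" "t \<ge> 0" "s \<noteq> t"
  shows "(law s y - law t y) / (s - t) =
    (\<Sum>x\<in>UNIV. law (min s t) x * ((trans_prob \<bar>s - t\<bar> x y - of_bool (y = x)) / \<bar>s - t\<bar>))"
proof -
  have *: "(law (a + h) y - law a y) / h =
      (\<Sum>x\<in>UNIV. law a x * ((trans_prob h x y - of_bool (y = x)) / h))" if "a \<ge> 0" "h > 0" for a h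
  proof -
    \<comment> \<open>\<open>law a y\<close> is written as a step by the identity, so that the
      difference becomes a single sum over \<open>x\<close>.\<close>
    have "law a y = (\<Sum>x\<in>UNIV. law a x * of_bool (y = x))"
      by (simp add: of_bool_def if_distrib sum.delta cong: if_cong)
    then have "law (a + h) y - law a y = (\<Sum>x\<in>UNIV. law a x * (trans_prob h x y - of_bool (y = x)))"
      using that by (simp only: law_step[of a h] sum_subtractf[symmetric] right_diff_distrib less_imp_le)
    then show ?thesis
      by (simp add: sum_divide_distrib)
  qed
  show ?thesis
  proof (cases "t < s")
    case True
    then show ?thesis
      using *[of t "s - t"] assms by (simp add: min_def)
  next
    case False
    then have "(law s y - law t y) / (s - t) = (law t y - law s y) / (t - s)"
      by (metis minus_diff_eq minus_divide_divide)
    then show ?thesis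
      using *[of s "t - s"] assms False by (simp add: min_def abs_minus_commute)
  qed
qed

lemma distance_at_right_0: "filterlim (\<lambda>s. \<bar>s - t\<bar>) (at_right 0) (at t within A)" for t :: real
  unfolding filterlim_at
proof
  show "((\<lambda>s. \<bar>s - t\<bar>) \<longlongrightarrow> 0) (at t within A)"
    by (auto intro!: tendsto_eq_intros)
  show "\<forall>\<^sub>F s in at t within A. \<bar>s - t\<bar> \<in> {0<..} \<and> \<bar>s - t\<bar> \<noteq> 0"
    by (auto simp: eventually_at_filter)
qed

lemma law_difference_eventually:
  assumes "t \<ge> 0"
  shows "\<forall>\<^sub>F s in at t within {0..}. (law s y - law t y) / (s - t) =
    (\<Sum>x\<in>UNIV. law (min s t) x * ((trans_prob \<bar>s - t\<bar> x y - of_bool (y = x)) / \<bar>s - t\<bar>))"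
  using assms by (auto simp: eventually_at_filter law_difference_quotient)

lemma trans_prob_rate_distance:
  "((\<lambda>s. (trans_prob \<bar>s - t\<bar> x y - of_bool (y = x)) / \<bar>s - t\<bar>)
     \<longlongrightarrow> (if reachable x then Q x y else 0)) (at t within A)"
  by (rule filterlim_compose[OF trans_prob_rate distance_at_right_0])

text \<open>In a left quotient the weights \<open>law s x\<close> move with \<open>s\<close>, so
  continuity must precede differentiability. The difference quotient stays bounded, because the rate
  quotients converge and the weights lie in [0,1]; multiplied by the distance from \<open>s\<close>
  to \<open>t\<close> it tends to 0.\<close>

lemma law_tendsto:
  assumes "t \<ge> 0"
  shows "((\<lambda>s. law s y) \<longlongrightarrow> law t y) (at t within {0..})"
proof -
  let ?d = "\<lambda>s x. (trans_prob \<bar>s - t\<bar> x y - of_bool (y = x)) / \<bar>s - t\<bar>"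
  have "((\<lambda>s. (\<Sum>x\<in>UNIV. \<bar>?d s x\<bar>) * \<bar>s - t\<bar>) \<longlongrightarrow>
      (\<Sum>x\<in>UNIV. \<bar>if reachable x then Q x y else 0\<bar>) * \<bar>t - t\<bar>) (at t within {0..})"
    by (intro tendsto_intros trans_prob_rate_distance)
  then have "((\<lambda>s. (\<Sum>x\<in>UNIV. \<bar>?d s x\<bar>) * \<bar>s - t\<bar>) \<longlongrightarrow> 0) (at t within {0..})"
    by simp
  moreover have "\<forall>\<^sub>F s in at t within {0..}. norm (law s y - law t y) \<le> (\<Sum>x\<in>UNIV. \<bar>?d s x\<bar>) * \<bar>s - t\<bar>"
    using law_difference_eventually[OF assms, of y] eventually_neq_at_within[of t t "{0..}"]
  proof eventually_elim
    case (elim s)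
    have "\<bar>(law s y - law t y) / (s - t)\<bar> \<le> (\<Sum>x\<in>UNIV. \<bar>law (min s t) x * ?d s x\<bar>)"
      unfolding elim(1) by (rule sum_abs)
    also have "\<dots> \<le> (\<Sum>x\<in>UNIV. \<bar>?d s x\<bar>)"
      by (intro sum_mono) (auto simp only: abs_mult abs_of_nonneg[OF law_nonneg]
          intro!: mult_left_le_one_le law_nonneg law_le_1 abs_ge_zero)
    finally show ?case
      using elim(2) by (simp only: abs_divide real_norm_def) (simp add: pos_divide_le_eq)
  qed
  ultimately have "((\<lambda>s. law s y - law t y) \<longlongrightarrow> 0) (at t within {0..})"
    by (rule Lim_null_comparison[rotated])
  then show ?thesis
    by (simp add: LIM_zero_iff)
qed

theorem forward_equation:
  assumes "t \<ge> 0"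
  shows "((\<lambda>s. law s y) has_real_derivative (\<Sum>x\<in>UNIV. law t x * Q x y)) (at t within {0..})"
proof -
  have "((\<lambda>s. law (min s t) x) \<longlongrightarrow> law t x) (at t within {0..})" for x
  proof -
    \<comment> \<open>To the right of \<open>t\<close> the weight is the constant
      \<open>law t x\<close>; to the left it is \<open>law s x\<close>, where continuity
      applies.\<close>
    have "((\<lambda>s. if s \<le> t then law s x else law t x) \<longlongrightarrow> law t x) (at t within {0..})"
      by (rule filterlim_If)
        (auto intro: filterlim_mono[OF law_tendsto[OF assms]] simp: inf.coboundedI1)
    then show ?thesis
      by (simp add: min_def if_distrib[of "\<lambda>s. law s x"])
  qed
  then have "((\<lambda>s. \<Sum>x\<in>UNIV. law (min s t) x * ((trans_prob \<bar>s - t\<bar> x y - of_bool (y = x)) / \<bar>s - t\<bar>))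
      \<longlongrightarrow> (\<Sum>x\<in>UNIV. law t x * (if reachable x then Q x y else 0))) (at t within {0..})"
    by (intro tendsto_sum tendsto_mult trans_prob_rate_distance)
  \<comment> \<open>An unreachable state has law 0 at time \<open>t\<close>, so its default rate 0
    may be replaced by \<open>Q x y\<close>.\<close>
  also have "(\<Sum>x\<in>UNIV. law t x * (if reachable x then Q x y else 0)) = (\<Sum>x\<in>UNIV. law t x * Q x y)"
  proof (rule sum.cong[OF refl])
    fix x
    show "law t x * (if reachable x then Q x y else 0) = law t x * Q x y"
      using assms law_nonneg[of t x] by (auto simp: reachable_def order.order_iff_strict)
  qed
  finally have "((\<lambda>s. (law s y - law t y) / (s - t)) \<longlongrightarrow> (\<Sum>x\<in>UNIV. law t x * Q x y)) (at t within {0..})"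
    by (rule Lim_transform_eventually)
      (use law_difference_eventually[OF assms, of y] in \<open>simp add: eq_commute\<close>)
  then show ?thesis
    by (simp add: has_field_derivative_iff)
qed

section \<open>Derivatives of expectations\<close>

lemma expectation_eq_sum_law:
  assumes "t \<ge> 0"
  shows "expectation (\<lambda>\<omega>. \<phi> (X t \<omega>)) = (\<Sum>x\<in>UNIV. law t x * \<phi> x)"
proof -
  have "expectation (\<lambda>\<omega>. \<phi> (X t \<omega>)) =
      expectation (\<lambda>\<omega>. \<Sum>x\<in>UNIV. \<phi> x * indicator {\<omega> \<in> space P. X t \<omega> = x} \<omega>)"
    by (intro Bochner_Integration.integral_cong refl)
      (simp add: indicator_def of_bool_def if_distrib sum.delta cong: if_cong)
  also have "\<dots> = (\<Sum>x\<in>UNIV. law t x * \<phi> x)"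
    using assms
    by (subst Bochner_Integration.integral_sum)
      (auto intro!: integrable_mult_right integrable_real_indicator simp: law_def Int_absorb2
        emeasure_eq_measure mult.commute)
  finally show ?thesis .
qed

theorem expectation_has_nth_deriv_at_0:
  assumes "\<And>\<omega>. \<omega> \<in> space P \<Longrightarrow> X 0 \<omega> = x\<^sub>0"
  shows "has_nth_deriv_at_0 n (\<lambda>t. expectation (\<lambda>\<omega>. \<phi> (X t \<omega>)))
    ((generator_apply Q ^^ n) \<phi> x\<^sub>0)"
proof -
  \<comment> \<open>Witness for the sequence of derivatives: each differentiation applies the
    generator once more to the function.\<close>
  define F where "F i t = expectation (\<lambda>\<omega>. (generator_apply Q ^^ i) \<phi> (X t \<omega>))" for i t
  have "(F i has_real_derivative F (Suc i) t) (at t within {0..})" if "t \<ge> 0" for i t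
  proof -
    let ?\<psi> = "(generator_apply Q ^^ i) \<phi>"
    have "((\<lambda>s. \<Sum>y\<in>UNIV. law s y * ?\<psi> y) has_real_derivative
        (\<Sum>y\<in>UNIV. (\<Sum>x\<in>UNIV. law t x * Q x y) * ?\<psi> y)) (at t within {0..})"
      by (intro DERIV_sum DERIV_cmult_right forward_equation that)
    \<comment> \<open>Exchanging the sums moves \<open>Q\<close> from the law to the
      function.\<close>
    also have "(\<Sum>y\<in>UNIV. (\<Sum>x\<in>UNIV. law t x * Q x y) * ?\<psi> y) =
        (\<Sum>x\<in>UNIV. law t x * (generator_apply Q ^^ Suc i) \<phi> x)"
      by (simp add: generator_apply_def sum_distrib_left sum_distrib_right mult.assoc)
        (rule sum.swap)
    also have "\<dots> = F (Suc i) t"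
      unfolding F_def by (rule expectation_eq_sum_law[OF that, symmetric])
    \<comment> \<open>The finite sum is known to equal \<open>F i\<close> only at nonnegative times,
      hence the transfer within \<open>{0..}\<close>.\<close>
    finally show ?thesis
      by (rule has_field_derivative_transform_within[OF _ zero_less_one])
        (use that in \<open>auto simp: F_def expectation_eq_sum_law\<close>)
  qed
  moreover have "F n 0 = (generator_apply Q ^^ n) \<phi> x\<^sub>0"
    using assms by (simp add: F_def prob_space cong: Bochner_Integration.integral_cong)
  moreover have "F 0 = (\<lambda>t. expectation (\<lambda>\<omega>. \<phi> (X t \<omega>)))"
    by (simp add: F_def fun_eq_iff)
  ultimately show ?thesis
    unfolding has_nth_deriv_at_0_def by blast
qed

end

section \<open>The Bass generator\<close>

definition adopters :: "('n::finite \<Rightarrow> bool) \<Rightarrow> real" where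
  "adopters x = (\<Sum>j\<in>UNIV. of_bool (x j))"

text \<open>The diagonal entry is minus the sum of the jump rates, so each jump is paired with its
  share of the diagonal: its rate multiplies the increment of the function along the jump.\<close>

lemma generator_apply_bass:
  "generator_apply (bass_generator p q) \<phi> x =
    (\<Sum>j | \<not> x j. adoption_rate p q x j * (\<phi> (x(j := True)) - \<phi> x))"
proof -
  let ?r = "adoption_rate p q x"
  have "bass_generator p q x y = (\<Sum>j | \<not> x j. ?r j * (of_bool (y = x(j := True)) - of_bool (y = x)))"
    for y
  proof (cases "y = x")
    case True
    \<comment> \<open>For \<open>y = x\<close> only the second indicator survives, since a jump
      changes the value at \<open>j\<close>.\<close>
    then have "\<not> x j \<Longrightarrow> y \<noteq> x(j := True)" for j
      by (metis fun_upd_same)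
    then show ?thesis
      using True by (simp add: bass_generator_def sum_negf[symmetric])
  next
    case False
    have "(\<Sum>j | \<not> x j \<and> y = x(j := True). ?r j) = (\<Sum>j | \<not> x j. if y = x(j := True) then ?r j else 0)"
      by (simp add: sum.inter_filter[symmetric])
    also have "\<dots> = (\<Sum>j | \<not> x j. ?r j * of_bool (y = x(j := True)))"
      by (intro sum.cong) auto
    finally show ?thesis
      using False by (simp add: bass_generator_def)
  qed
  then have "generator_apply (bass_generator p q) \<phi> x =
      (\<Sum>y\<in>UNIV. \<Sum>j | \<not> x j. ?r j * (of_bool (y = x(j := True)) - of_bool (y = x)) * \<phi> y)"
    by (simp add: generator_apply_def sum_distrib_right)
  also have "\<dots> = (\<Sum>j | \<not> x j. \<Sum>y\<in>UNIV. ?r j * (of_bool (y = x(j := True)) - of_bool (y = x)) * \<phi> y)"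
    by (rule sum.swap)
  also have "\<dots> = (\<Sum>j | \<not> x j. ?r j * (\<phi> (x(j := True)) - \<phi> x))"
  proof (rule sum.cong[OF refl])
    fix j
    have "(\<Sum>y\<in>UNIV. ?r j * (of_bool (y = x(j := True)) - of_bool (y = x)) * \<phi> y) =
        ?r j * ((\<Sum>y\<in>UNIV. if y = x(j := True) then \<phi> y else 0) - (\<Sum>y\<in>UNIV. if y = x then \<phi> y else 0))"
      unfolding sum_subtractf[symmetric] sum_distrib_left by (intro sum.cong) auto
    then show "(\<Sum>y\<in>UNIV. ?r j * (of_bool (y = x(j := True)) - of_bool (y = x)) * \<phi> y) =
        ?r j * (\<phi> (x(j := True)) - \<phi> x)"
      by simp
  qed
  finally show ?thesis .
qed

lemma adoption_rate_upd:
  assumes "\<not> x i" "l \<noteq> i"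
  shows "adoption_rate p q (x(i := True)) l = adoption_rate p q x l + q i l"
proof -
  have "(\<Sum>k\<in>UNIV - {l}. q k l * of_bool ((x(i := True)) k)) =
      (\<Sum>k\<in>UNIV - {l}. q k l * of_bool (x k) + (if k = i then q k l else 0))"
    using assms by (intro sum.cong) auto
  then show ?thesis
    using assms by (simp add: adoption_rate_def sum.distrib)
qed

lemma adopters_upd:
  assumes "\<not> x i"
  shows "adopters (x(i := True)) = adopters x + 1"
proof -
  have "adopters (x(i := True)) = (\<Sum>j\<in>UNIV. of_bool (x j) + (if j = i then 1 else 0))"
    unfolding adopters_def using assms by (intro sum.cong) auto
  then show ?thesis
    by (simp add: adopters_def sum.distrib)
qed

lemma generator_adopters:
  "generator_apply (bass_generator p q) adopters x = (\<Sum>j | \<not> x j. adoption_rate p q x j)"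
  by (simp add: generator_apply_bass adopters_upd)

text \<open>The adoption of \<open>i\<close> removes its own rate from the total rate of the
  nonadopters and raises the rate of every remaining nonadopter \<open>l\<close> by
  \<open>q i l\<close>.\<close>

lemma generator_square_adopters:
  "generator_apply (bass_generator p q) (generator_apply (bass_generator p q) adopters) x =
    (\<Sum>i | \<not> x i. adoption_rate p q x i *
      ((\<Sum>l\<in>{l. \<not> x l} - {i}. q i l) - adoption_rate p q x i))"
proof -
  let ?r = "adoption_rate p q"
  have "(\<Sum>j | \<not> (x(i := True)) j. ?r (x(i := True)) j) - (\<Sum>j | \<not> x j. ?r x j) =
      (\<Sum>l\<in>{l. \<not> x l} - {i}. q i l) - ?r x i" if "\<not> x i" for i
  proof -
    have "(\<Sum>j | \<not> (x(i := True)) j. ?r (x(i := True)) j) = (\<Sum>j\<in>{l. \<not> x l} - {i}. ?r x j + q i j)"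
      using that by (intro sum.cong) (auto simp: adoption_rate_upd)
    moreover have "(\<Sum>j | \<not> x j. ?r x j) = ?r x i + (\<Sum>j\<in>{l. \<not> x l} - {i}. ?r x j)"
      using that by (simp add: sum.remove)
    ultimately show ?thesis
      by (simp add: sum.distrib)
  qed
  then show ?thesis
    by (subst generator_apply_bass) (simp add: generator_adopters)
qed

section \<open>Evaluation at the initial state\<close>

lemma sum_out_rates:
  "(\<Sum>i\<in>UNIV. \<Sum>l\<in>UNIV - {i}. q i l) = (\<Sum>j\<in>UNIV. internal_rate q j)"
proof -
  have "(\<Sum>i\<in>UNIV. \<Sum>l\<in>UNIV - {i}. q i l) = (\<Sum>i\<in>UNIV. \<Sum>l\<in>UNIV. if l \<noteq> i then q i l else 0)"
    by (intro sum.cong refl sum.mono_neutral_cong_left) auto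
  also have "\<dots> = (\<Sum>l\<in>UNIV. \<Sum>i\<in>UNIV. if l \<noteq> i then q i l else 0)"
    by (rule sum.swap)
  also have "\<dots> = (\<Sum>l\<in>UNIV. internal_rate q l)"
    unfolding internal_rate_def by (intro sum.cong refl sum.mono_neutral_cong_right) auto
  finally show ?thesis .
qed

text \<open>Without adopters every rate is \<open>p\<close>. In the third power the outermost
  generator creates a first adopter \<open>j\<close>; the square formula is then evaluated at that
  state, where a node \<open>i\<close> other than \<open>j\<close> has rate
  \<open>p + q j i\<close>.\<close>

lemma generator_powers_adopters_at_0:
  fixes q :: "'n::finite \<Rightarrow> 'n \<Rightarrow> real" and p :: real
  defines "A \<equiv> generator_apply (bass_generator (\<lambda>_. p) q)"
    and "M \<equiv> real CARD('n)"
  shows "(A ^^ 1) adopters (\<lambda>_. False) = M * p"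
    and "(A ^^ 2) adopters (\<lambda>_. False) = p * ((\<Sum>j\<in>UNIV. internal_rate q j) - M * p)"
    and "(A ^^ 3) adopters (\<lambda>_. False) = p * (\<Sum>j\<in>UNIV.
           (\<Sum>i\<in>UNIV - {j}. (p + q j i) * ((\<Sum>l\<in>UNIV - {j} - {i}. q i l) - (p + q j i)))
           - p * ((\<Sum>j\<in>UNIV. internal_rate q j) - M * p))"
proof -
  have r0: "adoption_rate (\<lambda>_. p) q (\<lambda>_. False) i = p" for i
    by (simp add: adoption_rate_def)
  show "(A ^^ 1) adopters (\<lambda>_. False) = M * p"
    by (simp add: A_def M_def generator_adopters r0)
  have A2: "A (A adopters) (\<lambda>_. False) = p * ((\<Sum>j\<in>UNIV. internal_rate q j) - M * p)"
    by (simp add: A_def M_def generator_square_adopters r0 sum_distrib_left[symmetric] sum_subtractf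
        sum_out_rates)
  then show "(A ^^ 2) adopters (\<lambda>_. False) = p * ((\<Sum>j\<in>UNIV. internal_rate q j) - M * p)"
    by (simp add: numeral_2_eq_2)
  have "A (A adopters) ((\<lambda>_. False)(j := True)) =
      (\<Sum>i\<in>UNIV - {j}. (p + q j i) * ((\<Sum>l\<in>UNIV - {j} - {i}. q i l) - (p + q j i)))" for j
  proof -
    have "{i. \<not> ((\<lambda>_. False)(j := True)) i} = UNIV - {j}"
      by auto
    then show ?thesis
      unfolding A_def generator_square_adopters
      by (intro sum.cong) (auto simp: adoption_rate_upd r0)
  qed
  then show "(A ^^ 3) adopters (\<lambda>_. False) = p * (\<Sum>j\<in>UNIV.
      (\<Sum>i\<in>UNIV - {j}. (p + q j i) * ((\<Sum>l\<in>UNIV - {j} - {i}. q i l) - (p + q j i)))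
      - p * ((\<Sum>j\<in>UNIV. internal_rate q j) - M * p))"
    using A2
    by (simp add: numeral_3_eq_3 A_def generator_apply_bass[of _ _ "generator_apply _ _"] r0
        sum_distrib_left)
qed

text \<open>If weights depend on the target only, the total weight from \<open>i\<close> to the
  nodes other than \<open>i\<close> and \<open>j\<close> is \<open>S - a j - a i\<close>, so each
  summand depends on two nodes only. The sum over distinct pairs is the full double sum less its
  diagonal.\<close>

lemma sum_out_rates_pair_complete:
  fixes a :: "'n::finite \<Rightarrow> real" and p :: real
  defines "M \<equiv> real CARD('n)" and "S \<equiv> sum a UNIV"
  assumes "\<And>i j. i \<noteq> j \<Longrightarrow> q i j = a j"
  shows "(\<Sum>j\<in>UNIV. \<Sum>i\<in>UNIV - {j}. (p + q j i) * ((\<Sum>l\<in>UNIV - {j} - {i}. q i l) - (p + q j i))) =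
    M * p * (M - 2) * S - M * (M - 1) * p\<^sup>2 - (2 * M - 3) * p * S + (M - 2) * S\<^sup>2
      - (M - 1) * p * S - (2 * M - 3) * (\<Sum>i\<in>UNIV. (a i)\<^sup>2)"
proof -
  let ?g = "\<lambda>i j. (p + a i) * (S - p - 2 * a i - a j)"
  have "(p + q j i) * ((\<Sum>l\<in>UNIV - {j} - {i}. q i l) - (p + q j i)) = ?g i j" if "i \<noteq> j" for i j
  proof -
    have "(\<Sum>l\<in>UNIV - {j} - {i}. q i l) = (\<Sum>l\<in>UNIV - {j} - {i}. a l)"
      using assms by (intro sum.cong) auto
    also have "\<dots> = S - a j - a i"
      using that by (simp add: sum_diff1 S_def)
    finally have "(\<Sum>l\<in>UNIV - {j} - {i}. q i l) = S - a j - a i" .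
    then show ?thesis
      using assms(3)[of j i] that by simp
  qed
  then have "(\<Sum>j\<in>UNIV. \<Sum>i\<in>UNIV - {j}. (p + q j i) * ((\<Sum>l\<in>UNIV - {j} - {i}. q i l) - (p + q j i))) =
      (\<Sum>j\<in>UNIV. (\<Sum>i\<in>UNIV - {j}. ?g i j))"
    by (intro sum.cong refl) auto
  \<comment> \<open>The closed form \<open>?g\<close> extends to \<open>i = j\<close>, where it
    equals \<open>(p + a j) * (S - p - 3 * a j)\<close>; this is subtracted again.\<close>
  also have "\<dots> = (\<Sum>j\<in>UNIV. \<Sum>i\<in>UNIV. ?g i j) - (\<Sum>j\<in>UNIV. ?g j j)"
    by (simp add: sum_diff1 sum_subtractf)
  \<comment> \<open>With \<open>j\<close> innermost the factor \<open>p + a i\<close> comes out of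
    the sum, and what remains is affine in \<open>a j\<close>.\<close>
  also have "(\<Sum>j\<in>UNIV. \<Sum>i\<in>UNIV. ?g i j) = (\<Sum>i\<in>UNIV. \<Sum>j\<in>UNIV. ?g i j)"
    by (rule sum.swap)
  also have "\<dots> - (\<Sum>j\<in>UNIV. ?g j j) =
      (\<Sum>i\<in>UNIV. (p + a i) * ((M - 2) * S - (M - 1) * p - (2 * M - 3) * a i))"
  proof -
    have row: "(\<Sum>j\<in>UNIV. S - p - 2 * a i - a j) = M * (S - p - 2 * a i) - S" for i
      unfolding sum_subtractf[of "\<lambda>_. S - p - 2 * a i" a] by (simp add: S_def M_def)
    show ?thesis
      unfolding sum_distrib_left[symmetric] row
      unfolding sum_subtractf[symmetric]
      by (intro sum.cong refl) (simp add: algebra_simps)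
  qed
  also have "\<dots> = (\<Sum>i\<in>UNIV. p * ((M - 2) * S - (M - 1) * p)
      + ((M - 2) * S - (M - 1) * p - (2 * M - 3) * p) * a i - (2 * M - 3) * (a i)\<^sup>2)"
    by (intro sum.cong refl) (simp add: algebra_simps power2_eq_square)
  also have "\<dots> = M * (p * ((M - 2) * S - (M - 1) * p))
      + ((M - 2) * S - (M - 1) * p - (2 * M - 3) * p) * S - (2 * M - 3) * (\<Sum>i\<in>UNIV. (a i)\<^sup>2)"
    by (simp add: sum.distrib sum_subtractf sum_distrib_left[symmetric] S_def[symmetric]
        M_def[symmetric])
  finally show ?thesis
    by (simp add: algebra_simps power2_eq_square)
qed

text \<open>In a complete network every degree is the number of nodes minus 1; this is the source of
  the denominators in the third derivative.\<close>

lemma mild_complete_rates: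
  fixes q :: "'n::finite \<Rightarrow> 'n \<Rightarrow> real"
  assumes "mild_heterogeneity q" "complete_network q" "i \<noteq> j"
  shows "q i j = internal_rate q j / (real CARD('n) - 1)"
proof -
  have "{i. influences q i j} = UNIV - {j}"
    using assms(2) by (auto simp: complete_network_def influences_def)
  then have "node_degree q j = CARD('n) - 1"
    by (simp add: node_degree_def)
  then show ?thesis
    using assms by (simp add: mild_heterogeneity_def complete_network_def of_nat_diff Suc_leI)
qed

section \<open>The first three derivatives of the adopter fraction\<close>

theorem corollary1:
  fixes P :: "'w measure"
    and X :: "real \<Rightarrow> 'w \<Rightarrow> 'n::finite \<Rightarrow> bool"
    and p M :: real
    and q :: "'n \<Rightarrow> 'n \<Rightarrow> real"
  assumes "discrete_bass P X (\<lambda>_. p) q"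
    and "M = real CARD('n)"
  shows "has_nth_deriv_at_0 1 (adopter_fraction P X) p
    \<and> has_nth_deriv_at_0 2 (adopter_fraction P X)
        (p * (1 / M * (\<Sum>j\<in>UNIV. internal_rate q j) - p))
    \<and> (mild_heterogeneity q \<and> complete_network q \<longrightarrow>
        has_nth_deriv_at_0 3 (adopter_fraction P X)
          (p ^ 3 + p / M *
             ((M - 2) / (M - 1)\<^sup>2 * (\<Sum>i\<in>UNIV. internal_rate q i)\<^sup>2
              - (2 * M - 3) / (M - 1)\<^sup>2 * (\<Sum>i\<in>UNIV. (internal_rate q i)\<^sup>2)
              - 4 * p * (\<Sum>i\<in>UNIV. internal_rate q i))))"
proof -
  interpret discrete_bass P X "\<lambda>_. p" q
    by (fact assms(1))
  let ?A = "generator_apply (bass_generator (\<lambda>_. p) q)"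
  let ?R = "\<Sum>j\<in>UNIV. internal_rate q j"
  have "M > 0"
    by (simp add: assms(2))
  have deriv: "has_nth_deriv_at_0 n (adopter_fraction P X) (1 / M * (?A ^^ n) adopters (\<lambda>_. False))"
    for n
  proof -
    have "has_nth_deriv_at_0 n (\<lambda>t. 1 / M * expectation (\<lambda>\<omega>. adopters (X t \<omega>)))
        (1 / M * (?A ^^ n) adopters (\<lambda>_. False))"
      by (intro has_nth_deriv_at_0_cmult expectation_has_nth_deriv_at_0)
        (simp add: fun_eq_iff initially_nonadopter)
    moreover have "adopter_fraction P X = (\<lambda>t. 1 / M * expectation (\<lambda>\<omega>. adopters (X t \<omega>)))"
      by (simp add: fun_eq_iff adopter_fraction_def adopters_def assms(2))
    ultimately show ?thesis
      by simp
  qed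
  note powers = generator_powers_adopters_at_0[of p q, folded assms(2)]
  have "has_nth_deriv_at_0 1 (adopter_fraction P X) p"
    using deriv[of 1] \<open>M > 0\<close> unfolding powers by simp
  moreover have "has_nth_deriv_at_0 2 (adopter_fraction P X) (p * (1 / M * ?R - p))"
    using deriv[of 2] \<open>M > 0\<close> unfolding powers by (simp add: field_simps)
  moreover have "has_nth_deriv_at_0 3 (adopter_fraction P X)
          (p ^ 3 + p / M *
             ((M - 2) / (M - 1)\<^sup>2 * ?R\<^sup>2
              - (2 * M - 3) / (M - 1)\<^sup>2 * (\<Sum>i\<in>UNIV. (internal_rate q i)\<^sup>2)
              - 4 * p * ?R))"
    if "mild_heterogeneity q" "complete_network q"
  proof -
    \<comment> \<open>Division by \<open>M - 1\<close> needs a second node: a single node would have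
      an empty sum as its internal rate, against positivity.\<close>
    have "M \<noteq> 1"
    proof
      assume "M = 1"
      then have "CARD('n) = 1"
        using assms(2) by simp
      then have "UNIV - {j} = {}" for j :: 'n
        by (metis Diff_cancel UNIV_I card_1_singletonE singletonD)
      then have "internal_rate q j = 0" for j
        unfolding internal_rate_def by (simp only: sum.empty)
      then show False
        using internal_rate_pos by simp
    qed
    \<comment> \<open>\<open>a j\<close> is the common weight of all edges into \<open>j\<close>;
      expressed through \<open>S\<close> and \<open>T\<close>, the denominators
      \<open>(M - 1)\<^sup>2\<close> cancel.\<close>
    define a where "a j = internal_rate q j / (M - 1)" for j
    define S where "S = sum a UNIV"
    define T where "T = (\<Sum>i\<in>UNIV. (a i)\<^sup>2)"
    have R: "?R = (M - 1) * S"
      using \<open>M \<noteq> 1\<close> by (simp add: S_def a_def sum_divide_distrib[symmetric])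
    have T: "(\<Sum>i\<in>UNIV. (internal_rate q i)\<^sup>2) = (M - 1)\<^sup>2 * T"
      using \<open>M \<noteq> 1\<close>
      by (simp add: T_def a_def power_divide sum_divide_distrib[symmetric])
    have "(?A ^^ 3) adopters (\<lambda>_. False) =
        p * (M * p * (M - 2) * S - M * (M - 1) * p\<^sup>2 - (2 * M - 3) * p * S + (M - 2) * S\<^sup>2
          - (M - 1) * p * S - (2 * M - 3) * T - M * (p * ((M - 1) * S - M * p)))"
      unfolding powers sum_subtractf R
      by (subst sum_out_rates_pair_complete[of q a])
        (simp_all add: mild_complete_rates[OF that] a_def S_def T_def assms(2))
    \<comment> \<open>Inside the outer factor \<open>p\<close>, the coefficients of
      \<open>p * S\<close> add up to \<open>- 4 * (M - 1)\<close> and those of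
      \<open>p\<^sup>2\<close> to \<open>M\<close>.\<close>
    also have "\<dots> = p * (M * p\<^sup>2 + (M - 2) * S\<^sup>2 - (2 * M - 3) * T - 4 * p * ((M - 1) * S))"
      by (simp add: algebra_simps power2_eq_square)
    also have "1 / M * \<dots> = p ^ 3 + p / M * ((M - 2) / (M - 1)\<^sup>2 * ?R\<^sup>2
        - (2 * M - 3) / (M - 1)\<^sup>2 * (\<Sum>i\<in>UNIV. (internal_rate q i)\<^sup>2) - 4 * p * ?R)"
      using \<open>M > 0\<close> \<open>M \<noteq> 1\<close> unfolding R T
      by (simp add: power_mult_distrib) (simp add: field_simps power2_eq_square power3_eq_cube)
    finally show ?thesis
      using deriv[of 3] by simp
  qed
  ultimately show ?thesis
    by blast
qed

end
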